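(* Let $A$ be a finite alphabet, let $x \in A^{\mathbb{Z}}$, and let $X = \overline{\mathcal{O}(x)}$. If $x$ is not uniformly recurrent, it is not true that $x$ is eventually periodic in both directions, and $\liminf_{n\to\infty} (c_n(X) - 2n) = -\infty$, then $X$ is uniquely ergodic, and its unique shift-invariant Borel probability measure is supported on a periodic orbit.
   Context: $\sigma$ denotes the left shift on $A^{\mathbb{Z}}$ (product topology), $\mathcal{O}(x) = \{\sigma^n x : n \in \mathbb{Z}\}$, and $\overline{\mathcal{O}(x)}$ is its closure. A word over a finite set $A$ is an element of $A^n$, $n \in \mathbb{N} = \{1,2,\dots\}$; $n$ is its length. A word $w$ is a subword of a sequence $x \in A^{\mathbb{Z}}$ if there is $i$ with $x(i+j) = w(j)$ for all $1 \le j \le |w|$ (and similarly for subwords of words). $c_n(X)$ is the number of distinct words of length $n$ that are subwords of some point of $X$. The sequence $x$ is uniformly recurrent if for every subword $w$ of $x$ there exists $N$ such that every $N$-letter subword of $x$ contains $w$ as a subword. A one-sided sequence $u \in A^{\mathbb{N}}$ is eventually periodic if there exist $n, N \in \mathbb{N}$ such that $u(k) = u(k+n)$ for all $k > N$; analogously for left-infinite sequences. A bi-infinite $x$ is eventually periodic in both directions if $x(0)x(1)x(2)\ldots$ and $\ldots x(-2)x(-1)$ are each eventually periodic. $X$ is uniquely ergodic if there is exactly one $\sigma$-invariant Borel probability measure on $X$. A periodic orbit is the (finite) orbit $\mathcal{O}(p)$ of a periodic sequence $p$, i.e. one for which there is $n \ne 0$ with $p(k)=p(k+n)$ for all $k \in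 \mathbb{Z}$. *)

theory Defs
  imports "HOL-Probability.Probability" "HOL-Library.Sublist"
begin

text \<open>
  The alphabet is a type of sort \<open>{finite, discrete_topology}\<close>, so that the library topology on
  \<open>int \<Rightarrow> 'a\<close> is the product of the discrete topologies, with its own \<open>closure\<close> and \<open>borel\<close>.
\<close>

text \<open>The integer power \<open>\<sigma>\<close> to the \<open>n\<close> of the left shift.\<close>

definition shift_pow :: "int \<Rightarrow> (int \<Rightarrow> 'a) \<Rightarrow> (int \<Rightarrow> 'a)"
  where "shift_pow n x = (\<lambda>k. x (k + n))"

abbreviation left_shift :: "(int \<Rightarrow> 'a) \<Rightarrow> (int \<Rightarrow> 'a)"
  where "left_shift \<equiv> shift_pow 1"

lemma shift_pow_0: "shift_pow 0 x = x"
  by (simp add: shift_pow_def)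

lemma shift_pow_add: "shift_pow (m + n) x = shift_pow m (shift_pow n x)"
  by (simp add: shift_pow_def add.assoc)

definition orbit :: "(int \<Rightarrow> 'a) \<Rightarrow> (int \<Rightarrow> 'a) set"
  where "orbit x = range (\<lambda>n. shift_pow n x)"

definition orbit_closure :: "(int \<Rightarrow> 'a::topological_space) \<Rightarrow> (int \<Rightarrow> 'a) set"
  where "orbit_closure x = closure (orbit x)"

text \<open>
  Words are lists, with letters indexed from 0. Subwords of words are given by \<^const>\<open>sublist\<close>
  (contiguous sublists).
\<close>

definition subword :: "'a list \<Rightarrow> (int \<Rightarrow> 'a) \<Rightarrow> bool"
  where "subword w x \<longleftrightarrow> (\<exists>i. \<forall>j<length w. x (i + int j) = w ! j)"

definition word_complexity :: "(int \<Rightarrow> 'a) set \<Rightarrow> nat \<Rightarrow> nat"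
  where "word_complexity X n = card {w. length w = n \<and> (\<exists>y\<in>X. subword w y)}"

definition uniformly_recurrent :: "(int \<Rightarrow> 'a) \<Rightarrow> bool"
  where "uniformly_recurrent x \<longleftrightarrow>
    (\<forall>w. w \<noteq> [] \<and> subword w x \<longrightarrow>
      (\<exists>N>0. \<forall>v. length v = N \<and> subword v x \<longrightarrow> sublist w v))"

definition eventually_periodic :: "(nat \<Rightarrow> 'a) \<Rightarrow> bool"
  where "eventually_periodic u \<longleftrightarrow> (\<exists>n>0. \<exists>N. \<forall>k>N. u k = u (k + n))"

text \<open>The left half \<open>\<dots> x(-2) x(-1)\<close> is read from right to left.\<close>

definition eventually_periodic_both :: "(int \<Rightarrow> 'a) \<Rightarrow> bool"
  where "eventually_periodic_both x \<longleftrightarrow>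
    eventually_periodic (\<lambda>k. x (int k)) \<and> eventually_periodic (\<lambda>k. x (- 1 - int k))"

definition periodic :: "(int \<Rightarrow> 'a) \<Rightarrow> bool"
  where "periodic p \<longleftrightarrow> (\<exists>n. n \<noteq> 0 \<and> (\<forall>k. p k = p (k + n)))"

text \<open>
  Borel probability measures on the subspace \<open>X\<close> preserved by the shift. Measurability of the
  shift is required explicitly because \<^const>\<open>distr\<close> is only meaningful for measurable maps.
\<close>

definition invariant_measures :: "(int \<Rightarrow> 'a::topological_space) set \<Rightarrow> (int \<Rightarrow> 'a) measure set"
  where "invariant_measures X = {M. prob_space M \<and> sets M = sets (restrict_space borel X) \<and>
    left_shift \<in> measurable M M \<and> distr M M left_shift = M}"

definition uniquely_ergodic :: "(int \<Rightarrow> 'a::topological_space) set \<Rightarrow> bool"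
  where "uniquely_ergodic X \<longleftrightarrow> (\<exists>!M. M \<in> invariant_measures X)"

definition supported_on_periodic_orbit ::
    "(int \<Rightarrow> 'a::topological_space) set \<Rightarrow> (int \<Rightarrow> 'a) measure \<Rightarrow> bool"
  where "supported_on_periodic_orbit X M \<longleftrightarrow>
    (\<exists>p. periodic p \<and> orbit p \<subseteq> X \<and> emeasure M (orbit p) = 1)"

end

theory Submission
  imports Defs
begin

text \<open>
  Let \<open>c n\<close> be the number of words of length \<open>n\<close> in \<open>x\<close>. As \<open>c n - 2 * n\<close> is unbounded below, there
  are arbitrarily large \<open>n\<close> with \<open>c (n + 1) \<le> c n + 1\<close> and \<open>c n \<le> 2 * n\<close>
  (\<open>ex_length_with_growth_le_one\<close>). Fix such an \<open>n\<close> and regard \<open>x\<close> as a walk in the graph whose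
  vertices are its words of length \<open>n\<close> and whose edges are its words of length \<open>n + 1\<close>. After a
  reversal, the right half of \<open>x\<close> is not eventually periodic. Then the graph has exactly one
  branching vertex \<open>r\<close>, with exactly two outgoing edges. Elsewhere the walk is deterministic, so it
  returns to \<open>r\<close> within \<open>c n\<close> steps (\<open>branching_word_in_every_long_window\<close>).

  As \<open>x\<close> is not uniformly recurrent, some word \<open>w\<close> of \<open>x\<close> is omitted by arbitrarily long words of
  \<open>x\<close>, and by compactness by a sequence \<open>p\<close> in the orbit closure
  (\<open>not_uniformly_recurrent_imp_avoiding\<close>). On the other hand, \<open>w\<close> occurs arbitrarily far to the
  right in \<open>x\<close>, for a last occurrence would produce \<open>2 * n\<close> words up to a constant
  (\<open>slow_growth_imp_occurs_arbitrarily_far_right\<close>). Hence one of the two edges at \<open>r\<close> forces the walk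
  to run into \<open>w\<close> when \<open>n\<close> is large. The walk of \<open>p\<close> cannot use this edge, so it is deterministic
  and \<open>p\<close> is periodic (\<open>avoiding_sequence_deterministic\<close>). It also visits \<open>r\<close>, as all walks do.
  Therefore every window of length \<open>3 * n\<close> in every point of the orbit closure contains a word of \<open>p\<close>
  of length \<open>n\<close>, namely \<open>r\<close>.

  Since this holds for a fixed \<open>p\<close> and arbitrarily large \<open>n\<close>, long words of \<open>p\<close> cover a proportion of
  each point that is bounded below. Applied to the invariant complement of the orbit of \<open>p\<close>, this shows
  that the complement is null for every invariant measure
  (\<open>invariant_measure_null_off_syndetic_orbit\<close>). What remains is the uniform measure on a finite orbit.
\<close>

section \<open>Windows and factors of bi-infinite sequences\<close>

definition window :: "(int \<Rightarrow> 'a) \<Rightarrow> int \<Rightarrow> nat \<Rightarrow> 'a list"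
  where "window x i n = map (\<lambda>j. x (i + int j)) [0..<n]"

definition factors :: "(int \<Rightarrow> 'a) \<Rightarrow> nat \<Rightarrow> 'a list set"
  where "factors x n = range (\<lambda>i. window x i n)"

lemma length_window [simp]: "length (window x i n) = n"
  by (simp add: window_def)

lemma window_eq_iff: "window x i n = window y k n \<longleftrightarrow> (\<forall>j<n. x (i + int j) = y (k + int j))"
  by (auto simp: window_def list_eq_iff_nth_eq)

lemma take_window: "m \<le> n \<Longrightarrow> take m (window x i n) = window x i m"
  by (simp add: window_def take_map)

lemma window_in_factors [simp]: "window x i n \<in> factors x n"
  by (simp add: factors_def)

lemma finite_factors [simp]: "finite (factors (x :: int \<Rightarrow> 'a::finite) n)"
proof (rule finite_subset)
  show "factors x n \<subseteq> {xs. set xs \<subseteq> UNIV \<and> length xs = n}" by (auto simp: factors_def)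
qed (rule finite_lists_length_eq, simp)

lemma window_Suc_eq_iff:
  "window x i (Suc n) = window y k (Suc n) \<longleftrightarrow>
    window x i n = window y k n \<and> x (i + int n) = y (k + int n)"
  by (auto simp: window_eq_iff less_Suc_eq)

lemma window_Suc_imp_next:
  assumes "window x i (Suc n) = window y k (Suc n)"
  shows "window x (i + 1) n = window y (k + 1) n"
  unfolding window_eq_iff
proof (intro allI impI)
  fix j assume "j < n"
  with assms have "x (i + int (Suc j)) = y (k + int (Suc j))" by (simp only: window_eq_iff)
  then show "x (i + 1 + int j) = y (k + 1 + int j)" by (simp add: algebra_simps)
qed

lemma window_subwindow:
  assumes "window x i n = window y k n" and "s + m \<le> n"
  shows "window x (i + int s) m = window y (k + int s) m"
  unfolding window_eq_iff
proof (intro allI impI)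
  fix j assume "j < m"
  with assms have "x (i + int (s + j)) = y (k + int (s + j))" by (simp only: window_eq_iff)
  then show "x (i + int s + int j) = y (k + int s + int j)" by (simp add: algebra_simps)
qed

lemma factors_take: "factors x n = take n ` factors x (Suc n)"
  by (auto simp: factors_def take_window image_image)

lemma card_factors_mono: "card (factors (x :: int \<Rightarrow> 'a::finite) n) \<le> card (factors x (Suc n))"
  by (subst factors_take) (simp add: card_image_le)

section \<open>Branching and eventual periodicity\<close>

text \<open>
  If the next letter is a function of the last \<open>n\<close> letters, two equal windows continue equally for
  ever; by pigeonhole such windows exist within \<open>C\<close> steps. The bounds on \<open>i\<close> and \<open>d\<close> are
  recorded so that the lemma can later be applied from positions that tend to minus infinity and
  still give one common period.
\<close>

lemma determined_windows_imp_periodic: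
  fixes x :: "int \<Rightarrow> 'a::finite"
  assumes det: "\<And>i j. i \<ge> a \<Longrightarrow> j \<ge> a \<Longrightarrow> window x i n = window x j n \<Longrightarrow> x (i + int n) = x (j + int n)"
  defines "C \<equiv> card (factors x n)"
  shows "\<exists>i d. a \<le> i \<and> i \<le> a + int C \<and> 1 \<le> d \<and> d \<le> C \<and> (\<forall>k\<ge>i. x (k + int d) = x k)"
proof -
  let ?f = "\<lambda>s. window x (a + int s) n"
  have "\<not> inj_on ?f {0..C}"
  proof
    assume "inj_on ?f {0..C}"
    then have "card {0..C} \<le> card (factors x n)"
      by (rule card_inj_on_le) auto
    then show False by (simp add: C_def)
  qed
  then obtain s t where st: "s < t" "t \<le> C" "?f s = ?f t"
    unfolding inj_on_def by (metis atLeastAtMost_iff linorder_neqE_nat)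
  have eq: "window x (a + int s + int u) n = window x (a + int t + int u) n" for u
  proof (induction u)
    case 0 then show ?case using st by simp
  next
    case (Suc u)
    then have "window x (a + int s + int u) (Suc n) = window x (a + int t + int u) (Suc n)"
      unfolding window_Suc_eq_iff using det[OF _ _ Suc] by simp
    from window_Suc_imp_next[OF this] show ?case by (simp add: algebra_simps)
  qed
  have next_eq: "x (a + int s + int u + int n) = x (a + int t + int u + int n)" for u
    by (rule det) (simp_all add: eq)
  have per: "x (k + int (t - s)) = x k" if "k \<ge> a + int s" for k
  proof -
    define u where "u = nat (k - (a + int s))"
    have k: "k = a + int s + int u" using that by (simp add: u_def)
    have kt: "k + int (t - s) = a + int t + int u" using k st by simp
    show ?thesis
    proof (cases "n = 0")
      case True then show ?thesis using next_eq[of u] unfolding kt by (simp add: k)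
    next
      case False
      then have "x (a + int s + int u + int 0) = x (a + int t + int u + int 0)"
        using eq[of u] unfolding window_eq_iff by blast
      then show ?thesis unfolding kt by (simp add: k)
    qed
  qed
  show ?thesis
    using st per by (intro exI[of _ "a + int s"] exI[of _ "t - s"]) auto
qed

lemma not_eventually_periodic_imp_branching:
  fixes x :: "int \<Rightarrow> 'a::finite"
  assumes "\<not> eventually_periodic (\<lambda>k. x (int k))"
  obtains i j where "i \<ge> a" "j \<ge> a" "window x i n = window x j n" "x (i + int n) \<noteq> x (j + int n)"
proof -
  note found = that
  show ?thesis
  proof (rule ccontr)
    assume none: "\<not> thesis"
    have "x (i + int n) = x (j + int n)"
      if "i \<ge> a" "j \<ge> a" "window x i n = window x j n" for i j
      using found[OF that] none by blast
    then obtain i d where "1 \<le> d" "\<forall>k\<ge>i. x (k + int d) = x k"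
      using determined_windows_imp_periodic[of a x n] by metis
    then have "eventually_periodic (\<lambda>k. x (int k))"
      unfolding eventually_periodic_def
      by (intro exI[of _ d] conjI exI[of _ "nat i"]) auto
    with assms show False ..
  qed
qed

text \<open>
  The one-sided Morse--Hedlund bound: a right half that is not eventually periodic has a branching
  word of each length, so its complexity is strictly increasing.
\<close>

lemma card_right_factors_gt:
  fixes x :: "int \<Rightarrow> 'a::finite"
  assumes "\<not> eventually_periodic (\<lambda>k. x (int k))"
  shows "n < card ((\<lambda>i. window x i n) ` {a..})"
proof (induction n)
  case 0
  have "(\<lambda>i. window x i 0) ` {a..} = {[]}" by (auto simp: window_def)
  then show ?case by simp
next
  case (Suc n)
  let ?F = "\<lambda>n. (\<lambda>i. window x i n) ` {a..}"
  have fin: "finite (?F m)" for m by (rule finite_subset[OF _ finite_factors[of x m]]) auto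
  have img: "?F n = take n ` ?F (Suc n)" by (simp add: image_image take_window)
  obtain i j where ij: "i \<ge> a" "j \<ge> a" "window x i n = window x j n" "x (i + int n) \<noteq> x (j + int n)"
    using not_eventually_periodic_imp_branching[OF assms] .
  then have "window x i (Suc n) \<in> ?F (Suc n)" "window x j (Suc n) \<in> ?F (Suc n)"
    and "take n (window x i (Suc n)) = take n (window x j (Suc n))"
    and "window x i (Suc n) \<noteq> window x j (Suc n)"
    by (auto simp: take_window window_Suc_eq_iff intro!: imageI)
  then have "\<not> inj_on (take n) (?F (Suc n))" by (metis inj_onD)
  then have "card (?F n) \<noteq> card (?F (Suc n))"
    unfolding img using fin eq_card_imp_inj_on by metis
  moreover have "card (?F n) \<le> card (?F (Suc n))"
    unfolding img by (rule card_image_le[OF fin])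
  ultimately show ?case using Suc by simp
qed

lemma inj_on_remove_collision:
  assumes "finite A" "card A \<le> Suc (card (f ` A))" "u \<in> A" "v \<in> A" "u \<noteq> v" "f u = f v"
  shows "inj_on f (A - {u})"
proof (rule eq_card_imp_inj_on)
  have "f ` (A - {u}) = f ` A"
  proof
    show "f ` A \<subseteq> f ` (A - {u})"
    proof
      fix z assume "z \<in> f ` A"
      then obtain a where "a \<in> A" "z = f a" by blast
      then show "z \<in> f ` (A - {u})"
        using assms(4-6) by (cases "a = u") (auto intro: rev_image_eqI)
    qed
  qed auto
  moreover have "card (f ` (A - {u})) \<le> card (A - {u})" using assms(1) by (intro card_image_le) auto
  ultimately show "card (f ` (A - {u})) = card (A - {u})" using assms by auto
qed (use assms in auto)

text \<open>
  View words of length \<open>n\<close> as vertices and words of length \<open>n + 1\<close> as edges, an edge leaving the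
  vertex given by its first \<open>n\<close> letters. There is a vertex with two outgoing edges \<open>u \<noteq> v\<close>; if
  there is at most one more edge than vertices, every other branching is excluded. Injectivity
  off \<open>u\<close> and injectivity off \<open>v\<close> are both needed later, since the edge that a given walk never
  takes can be either of the two.
\<close>

lemma growth_le_one_imp_single_branching:
  fixes x :: "int \<Rightarrow> 'a::finite"
  assumes "\<not> eventually_periodic (\<lambda>k. x (int k))"
    and "card (factors x (Suc n)) \<le> Suc (card (factors x n))"
  obtains u v where "u \<noteq> v" "take n u = take n v" "u \<in> factors x (Suc n)" "v \<in> factors x (Suc n)"
    "inj_on (take n) (factors x (Suc n) - {u})" "inj_on (take n) (factors x (Suc n) - {v})"
proof -
  obtain i j where ij: "window x i n = window x j n" "x (i + int n) \<noteq> x (j + int n)"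
    using not_eventually_periodic_imp_branching[OF assms(1)] .
  show thesis
    by (rule that[of "window x i (Suc n)" "window x j (Suc n)"])
      (use ij assms(2) in \<open>auto simp: window_Suc_eq_iff take_window factors_take[of x n]
        intro!: inj_on_remove_collision[of _ "take n" "window x i (Suc n)" "window x j (Suc n)"]
          inj_on_remove_collision[of _ "take n" "window x j (Suc n)" "window x i (Suc n)"]\<close>)
qed

section \<open>The graph of words at a length of small growth\<close>

text \<open>
  If \<open>w\<close> had a last occurrence, then the \<open>n - length w + 1\<close> windows that contain it would be
  distinguished by its place in them, and all of them would differ from the more than \<open>n\<close> words that
  start to its right. That is \<open>2 * n\<close> words up to a constant, too many.
\<close>

lemma slow_growth_imp_occurs_arbitrarily_far_right:
  fixes x :: "int \<Rightarrow> 'a::finite"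
  assumes np: "\<not> eventually_periodic (\<lambda>k. x (int k))"
    and w: "w \<in> factors x (length w)"
    and slow: "\<And>B n0. \<exists>n\<ge>n0. card (factors x n) + B < 2 * n"
  obtains t where "t \<ge> a" "window x t (length w) = w"
proof -
  let ?m = "length w"
  have False if none: "\<And>t. t \<ge> a \<Longrightarrow> window x t ?m \<noteq> w"
  proof -
    obtain t0 where t0: "window x t0 ?m = w" using w unfolding factors_def by (metis rangeE)
    define g where "g = (LEAST g. window x (a - int g) ?m = w)"
    have "window x (a - int (nat (a - t0))) ?m = w"
    proof -
      have "t0 < a" using none[of t0] t0 by (cases "t0 < a") auto
      then show ?thesis using t0 by simp
    qed
    then have g: "window x (a - int g) ?m = w" unfolding g_def by (rule LeastI)
    define t where "t = a - int g"
    have t: "window x t ?m = w" using g by (simp add: t_def)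
    have last: "window x s ?m \<noteq> w" if "s > t" for s
    proof (cases "s \<ge> a")
      case False
      then have "nat (a - s) < g" using that by (simp add: t_def)
      from not_less_Least[OF this[unfolded g_def]] show ?thesis using False by simp
    qed (use none in blast)
    obtain n where n: "n \<ge> ?m" "card (factors x n) + ?m < 2 * n" using slow by blast
    let ?A = "(\<lambda>i. window x i n) ` {t + 1..}"
    let ?B = "(\<lambda>i. window x (t - int i) n) ` {0..n - ?m}"
    have inj: "inj_on (\<lambda>i. window x (t - int i) n) {0..n - ?m}"
    proof (rule linorder_inj_onI')
      fix i j assume ij: "i < j" "i \<in> {0..n - ?m}" "j \<in> {0..n - ?m}"
      show "window x (t - int i) n \<noteq> window x (t - int j) n"
      proof
        assume "window x (t - int i) n = window x (t - int j) n"
        from window_subwindow[OF this, of j ?m] n ij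
        have "window x (t - int i + int j) ?m = w" by (simp add: t)
        with last[of "t - int i + int j"] ij show False by simp
      qed
    qed
    have disj: "?A \<inter> ?B = {}"
    proof -
      have False if "s \<ge> t + 1" "i \<le> n - ?m" and e: "window x s n = window x (t - int i) n" for s i
        using window_subwindow[OF e, of i ?m] le_diff_conv2[OF n(1), of i] that(1,2) last[of "s + int i"]
        by (simp add: t)
      then show ?thesis by fastforce
    qed
    have fin: "finite ?A" by (rule finite_subset[OF _ finite_factors[of x n]]) auto
    have "card ?A + card ?B = card (?A \<union> ?B)"
      using fin disj by (intro card_Un_disjoint[symmetric]) auto
    also have "\<dots> \<le> card (factors x n)" by (rule card_mono) auto
    finally show False
      using card_right_factors_gt[OF np, of n "t + 1"] card_image[OF inj] n by simp
  qed
  with that show ?thesis by blast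
qed

text \<open>
  Away from the branching vertex \<open>take n u\<close> the graph of words is deterministic, also when the two
  walks belong to different sequences.
\<close>

lemma walks_agree_one_step:
  assumes inj: "inj_on (take n) (factors x (Suc n) - {u})"
    and "window y i (Suc n) \<in> factors x (Suc n)" "window z k (Suc n) \<in> factors x (Suc n)"
    and eq: "window y i n = window z k n" and ne: "window y i n \<noteq> take n u"
  shows "window y (i + 1) n = window z (k + 1) n"
proof (rule window_Suc_imp_next, rule inj_onD[OF inj])
  show "take n (window y i (Suc n)) = take n (window z k (Suc n))"
    using eq by (simp add: take_window)
  show "window y i (Suc n) \<in> factors x (Suc n) - {u}"
    using assms by (auto simp: take_window)
  show "window z k (Suc n) \<in> factors x (Suc n) - {u}"
    using assms by (auto simp: take_window)
qed

lemma walks_agree_up_to_branching: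
  assumes inj: "inj_on (take n) (factors x (Suc n) - {u})"
    and y: "\<And>i. window y i (Suc n) \<in> factors x (Suc n)"
    and z: "\<And>i. window z i (Suc n) \<in> factors x (Suc n)"
    and eq: "window y i n = window z k n"
    and ne: "\<And>s. s < t \<Longrightarrow> window y (i + int s) n \<noteq> take n u"
  shows "window y (i + int t) n = window z (k + int t) n"
  using ne
proof (induction t)
  case 0 then show ?case using eq by simp
next
  case (Suc t)
  then have "window y (i + int t) n = window z (k + int t) n" by simp
  from walks_agree_one_step[OF inj y z this] Suc.prems[of t] show ?case by (simp add: algebra_simps)
qed

text \<open>
  The walk of \<open>x\<close> meets the branching vertex arbitrarily far to the right, for otherwise it would be
  deterministic from some point on. Until it next meets that vertex it visits no vertex twice, so
  this takes fewer steps than there are vertices.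
\<close>

lemma branching_word_in_every_long_window:
  fixes x :: "int \<Rightarrow> 'a::finite"
  assumes np: "\<not> eventually_periodic (\<lambda>k. x (int k))"
    and inj: "inj_on (take n) (factors x (Suc n) - {u})"
  shows "\<exists>k < card (factors x n). window x (i + int k) n = take n u"
proof -
  obtain i' j' where "i' \<ge> i" "j' \<ge> i" and br: "window x i' n = window x j' n" "x (i' + int n) \<noteq> x (j' + int n)"
    using not_eventually_periodic_imp_branching[OF np] .
  have "window x i' n = take n u"
  proof (rule ccontr)
    assume "window x i' n \<noteq> take n u"
    then have "window x i' (Suc n) \<noteq> u" "window x j' (Suc n) \<noteq> u"
      using br(1) by (auto simp: take_window)
    moreover have "take n (window x i' (Suc n)) = take n (window x j' (Suc n))"
      using br(1) by (simp add: take_window)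
    ultimately have "window x i' (Suc n) = window x j' (Suc n)"
      using inj_onD[OF inj] by simp
    with br show False by (simp add: window_Suc_eq_iff)
  qed
  then have ex: "window x (i + int (nat (i' - i))) n = take n u" using \<open>i' \<ge> i\<close> by simp
  define k where "k = (LEAST k. window x (i + int k) n = take n u)"
  have k: "window x (i + int k) n = take n u" unfolding k_def by (rule LeastI, rule ex)
  have before: "window x (i + int s) n \<noteq> take n u" if "s < k" for s
    using not_less_Least[OF that[unfolded k_def]] .
  have "inj_on (\<lambda>s. window x (i + int s) n) {0..k}"
  proof (rule linorder_inj_onI')
    fix s t assume st: "s < t" "s \<in> {0..k}" "t \<in> {0..k}"
    show "window x (i + int s) n \<noteq> window x (i + int t) n"
    proof
      assume "window x (i + int s) n = window x (i + int t) n"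
      then have "window x (i + int s + int (k - t)) n = window x (i + int t + int (k - t)) n"
      proof (rule walks_agree_up_to_branching[OF inj window_in_factors window_in_factors])
        fix r assume "r < k - t"
        then have "s + r < k" using st by simp
        from before[OF this] show "window x (i + int s + int r) n \<noteq> take n u"
          by (simp add: add.assoc)
      qed
      moreover have "i + int s + int (k - t) = i + int (s + (k - t))" "i + int t + int (k - t) = i + int k"
        using st by auto
      ultimately have "window x (i + int (s + (k - t))) n = take n u" using k by metis
      moreover have "s + (k - t) < k" using st by auto
      ultimately show False using before by blast
    qed
  qed
  then have "card {0..k} \<le> card (factors x n)" by (rule card_inj_on_le) auto
  then show ?thesis using k by (intro exI[of _ k]) simp
qed

text \<open>
  Otherwise \<open>c n - 2 * n\<close> never decreases while it is at most 0, and elsewhere it drops by at most 2,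
  so it would be bounded below.
\<close>

lemma ex_length_with_growth_le_one:
  fixes c :: "nat \<Rightarrow> nat"
  assumes mono: "\<And>n. c n \<le> c (Suc n)" and slow: "\<And>B n0. \<exists>n\<ge>n0. c n + B < 2 * n"
  obtains n where "n \<ge> n0" "c (Suc n) \<le> Suc (c n)" "c n \<le> 2 * n"
proof -
  have False if none: "\<And>n. n \<ge> n0 \<Longrightarrow> c n \<le> 2 * n \<Longrightarrow> Suc (Suc (c n)) \<le> c (Suc n)"
  proof -
    \<comment> \<open>The constant covers the start value at \<open>n0\<close> and a drop by 2 from a positive value.\<close>
    have "2 * n \<le> c n + (2 * n0 + 1)" if "n \<ge> n0" for n
      using that
    proof (induction n rule: dec_induct)
      case (step n)
      then show ?case using none[of n] mono[of n] by (cases "c n \<le> 2 * n") auto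
    qed simp
    with slow[of n0 "2 * n0 + 1"] show False by fastforce
  qed
  with that show ?thesis by (metis not_less_eq_eq)
qed

text \<open>
  In \<open>x\<close> some visit to the branching vertex is followed by an occurrence of \<open>w\<close> before the next
  visit. The edge \<open>e\<close> taken at that visit forces the walk to run into \<open>w\<close>, so the \<open>w\<close>-free sequence
  \<open>p\<close> never takes it and is left with only one edge at the only branching vertex.
\<close>

lemma avoiding_sequence_deterministic:
  fixes x :: "int \<Rightarrow> 'a::finite"
  assumes np: "\<not> eventually_periodic (\<lambda>k. x (int k))"
    and low: "card (factors x (Suc n)) \<le> Suc (card (factors x n))"
    and occ: "\<And>a. \<exists>t\<ge>a. window x t (length w) = w" and len: "length w \<le> n"
    and p: "factors p (Suc n) \<subseteq> factors x (Suc n)"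
    and av: "w \<notin> factors p (length w)"
  shows "inj_on (take n) (factors p (Suc n))"
proof -
  obtain u v where uv: "u \<noteq> v" "take n u = take n v" "u \<in> factors x (Suc n)" "v \<in> factors x (Suc n)"
    and inj: "inj_on (take n) (factors x (Suc n) - {u})" "inj_on (take n) (factors x (Suc n) - {v})"
    using growth_le_one_imp_single_branching[OF np low] .
  have p': "window p i (Suc n) \<in> factors x (Suc n)" for i using p by auto
  obtain s0 where s0: "window x s0 n = take n u"
    using branching_word_in_every_long_window[OF np inj(1)] by blast
  obtain t where t: "t \<ge> s0" "window x t (length w) = w" using occ by blast
  define g where "g = (LEAST g. window x (t - int g) n = take n u)"
  have "window x (t - int (nat (t - s0))) n = take n u" using s0 t by simp
  then have g: "window x (t - int g) n = take n u" unfolding g_def by (rule LeastI)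
  have last: "window x (t - int h) n \<noteq> take n u" if "h < g" for h
    using not_less_Least[OF that[unfolded g_def]] .
  have no_w: "window p i n \<noteq> window x t n" for i
  proof
    assume "window p i n = window x t n"
    from window_subwindow[OF this, of 0 "length w"] len t have "window p i (length w) = w" by simp
    then show False using av by (metis window_in_factors)
  qed
  define e where "e = window x (t - int g) (Suc n)"
  \<comment> \<open>A third edge at the same vertex would contradict injectivity off \<open>u\<close>.\<close>
  have "e = u \<or> e = v"
  proof (rule ccontr)
    assume "\<not> ?thesis"
    then have "e \<in> factors x (Suc n) - {u}" "v \<in> factors x (Suc n) - {u}" "take n e = take n v"
      using uv g by (simp_all add: e_def take_window)
    with inj(1) have "e = v" by (metis inj_onD)
    with \<open>\<not> ?thesis\<close> show False by simp
  qed
  have "e \<notin> factors p (Suc n)"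
  proof
    assume "e \<in> factors p (Suc n)"
    then obtain j where j: "window p j (Suc n) = window x (t - int g) (Suc n)"
      by (auto simp: factors_def e_def)
    show False
    proof (cases g)
      case 0
      with j no_w[of j] show False by (simp add: window_Suc_eq_iff)
    next
      case (Suc h)
      have "window x (t - int g + 1 + int h) n = window p (j + 1 + int h) n"
      proof (rule walks_agree_up_to_branching[OF inj(1) window_in_factors p'])
        show "window x (t - int g + 1) n = window p (j + 1) n"
          using window_Suc_imp_next[OF j] by simp
        fix s assume "s < h"
        then show "window x (t - int g + 1 + int s) n \<noteq> take n u"
          using last[of "h - s"] Suc by (simp add: algebra_simps of_nat_diff)
      qed
      with no_w[of "j + 1 + int h"] Suc show False by simp
    qed
  qed
  then have "factors p (Suc n) \<subseteq> factors x (Suc n) - {e}" using p by blast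
  with \<open>e = u \<or> e = v\<close> show ?thesis using inj by (blast intro: inj_on_subset)
qed

text \<open>
  A deterministic sequence is periodic to the right of positions arbitrarily far to the left, with
  periods bounded by the number \<open>C\<close> of words; the factorial of \<open>C\<close> is a common multiple of these
  periods.
\<close>

lemma deterministic_imp_periodic:
  fixes p :: "int \<Rightarrow> 'a::finite"
  assumes "inj_on (take n) (factors p (Suc n))"
  obtains d where "d > 0" "\<And>k. p (k + int d) = p k"
proof
  let ?C = "card (factors p n)"
  show "fact ?C > (0::nat)" by simp
  fix k
  have det: "p (i + int n) = p (j + int n)" if "window p i n = window p j n" for i j
    using inj_onD[OF assms, of "window p i (Suc n)" "window p j (Suc n)"] that
    by (simp add: take_window window_Suc_eq_iff)
  obtain i d where "i \<le> k - int ?C + int ?C" and id: "1 \<le> d" "d \<le> ?C"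
    and per: "\<forall>k\<ge>i. p (k + int d) = p k"
    using determined_windows_imp_periodic[of "k - int ?C" p n] det by blast
  then have "i \<le> k" by simp
  have "p (k + int (m * d)) = p k" for m
  proof (induction m)
    case (Suc m)
    have "p (k + int (m * d) + int d) = p (k + int (m * d))" using \<open>i \<le> k\<close> by (intro per[rule_format]) (simp add: add_increasing2)
    with Suc show ?case by (simp add: algebra_simps)
  qed simp
  moreover have "d dvd fact ?C" using id by (intro dvd_fact)
  ultimately show "p (k + int (fact ?C)) = p k" by (metis dvd_div_mult_self)
qed

text \<open>
  At a length \<open>n\<close> of small growth, the branching word lies in every sufficiently long window of
  \<open>x\<close>. As windows of \<open>p\<close> are windows of \<open>x\<close>, it is also a word of \<open>p\<close>, and hence \<open>p\<close> supplies a word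
  of length \<open>n\<close> to every window of \<open>x\<close> of length \<open>3 * n\<close>. The sequence \<open>p\<close> is chosen before \<open>n\<close>, which
  is why the same periodic orbit serves all these lengths.
\<close>

lemma avoiding_sequence_if_not_right_periodic:
  fixes x :: "int \<Rightarrow> 'a::finite"
  assumes np: "\<not> eventually_periodic (\<lambda>k. x (int k))"
    and w: "w \<in> factors x (length w)"
    and slow: "\<And>B n0. \<exists>n\<ge>n0. card (factors x n) + B < 2 * n"
    and p: "\<And>n. factors p n \<subseteq> factors x n" and av: "w \<notin> factors p (length w)"
  shows "\<exists>d>0. \<forall>k. p (k + int d) = p k"
    and "\<exists>n\<ge>n0. \<forall>i. \<exists>k\<le>2*n. window x (i + int k) n \<in> factors p n"
proof -
  have occ: "\<exists>t\<ge>a. window x t (length w) = w" for a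
    using slow_growth_imp_occurs_arbitrarily_far_right[OF np w slow] by metis
  have good: "\<exists>n\<ge>n0. n \<ge> length w \<and> card (factors x (Suc n)) \<le> Suc (card (factors x n)) \<and> card (factors x n) \<le> 2 * n" for n0
    using ex_length_with_growth_le_one[OF card_factors_mono slow, of "max n0 (length w)"] by (metis max.bounded_iff)
  show "\<exists>d>0. \<forall>k. p (k + int d) = p k"
  proof -
    obtain n where "n \<ge> length w" "card (factors x (Suc n)) \<le> Suc (card (factors x n))" using good by blast
    from avoiding_sequence_deterministic[OF np this(2) occ this(1) p av] show ?thesis
      using deterministic_imp_periodic by metis
  qed
  obtain n where n: "n \<ge> n0" "card (factors x (Suc n)) \<le> Suc (card (factors x n))" "card (factors x n) \<le> 2 * n"
    using good by blast
  obtain u where inj: "inj_on (take n) (factors x (Suc n) - {u})"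
    using growth_le_one_imp_single_branching[OF np n(2)] by metis
  have hit: "\<exists>k\<le>2*n. window x (i + int k) n = take n u" for i
    using branching_word_in_every_long_window[OF np inj, of i] n(3) by (meson less_imp_le order_trans)
  have "window p 0 (3 * n) \<in> factors x (3 * n)" using p window_in_factors by blast
  then obtain i where i: "window x i (3 * n) = window p 0 (3 * n)" by (auto simp: factors_def)
  obtain k where k: "k \<le> 2 * n" "window x (i + int k) n = take n u" using hit by blast
  have "window p (0 + int k) n = take n u" using window_subwindow[OF i, of k n] k by simp
  then have "take n u \<in> factors p n" by (metis window_in_factors)
  with hit n show "\<exists>n\<ge>n0. \<forall>i. \<exists>k\<le>2*n. window x (i + int k) n \<in> factors p n" by metis
qed

section \<open>Reversal\<close>

text \<open>
  Reflection about \<open>- 1 / 2\<close>, which exchanges the two halves used in \<open>eventually_periodic_both\<close>.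
\<close>

definition reversed :: "(int \<Rightarrow> 'a) \<Rightarrow> (int \<Rightarrow> 'a)"
  where "reversed x = (\<lambda>k. x (- 1 - k))"

lemma window_reversed: "window (reversed x) i n = rev (window x (- i - int n) n)"
proof (rule nth_equalityI)
  fix j assume "j < length (window (reversed x) i n)"
  then have "j < n" by simp
  then show "window (reversed x) i n ! j = rev (window x (- i - int n) n) ! j"
    by (simp add: window_def reversed_def rev_nth of_nat_diff algebra_simps)
qed simp

lemma factors_reversed: "factors (reversed x) n = rev ` factors x n"
proof -
  have "range (\<lambda>i. - i - int n) = UNIV"
  proof (rule surjI)
    show "- (- i - int n) - int n = i" for i by simp
  qed
  have "factors (reversed x) n = rev ` (\<lambda>i. window x i n) ` range (\<lambda>i. - i - int n)"
    by (simp only: factors_def window_reversed image_image)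
  then show ?thesis by (simp only: \<open>range _ = UNIV\<close> factors_def)
qed

lemma card_factors_reversed: "card (factors (reversed x) n) = card (factors x n)"
  unfolding factors_reversed by (rule card_image) simp

text \<open>
  One of the two halves is not eventually periodic. All hypotheses and conclusions are invariant
  under reversal, so that half may be taken to be the right one.
\<close>

lemma avoiding_sequence_periodic_and_syndetic:
  fixes x :: "int \<Rightarrow> 'a::finite"
  assumes np: "\<not> eventually_periodic_both x"
    and w: "w \<in> factors x (length w)"
    and slow: "\<And>B n0. \<exists>n\<ge>n0. card (factors x n) + B < 2 * n"
    and p: "\<And>n. factors p n \<subseteq> factors x n" and av: "w \<notin> factors p (length w)"
  shows "\<exists>d>0. \<forall>k. p (k + int d) = p k"
    and "\<exists>n\<ge>n0. \<forall>i. \<exists>k\<le>2*n. window x (i + int k) n \<in> factors p n"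
proof -
  have "(\<exists>d>0. \<forall>k. p (k + int d) = p k) \<and>
    (\<exists>n\<ge>n0. \<forall>i. \<exists>k\<le>2*n. window x (i + int k) n \<in> factors p n)"
  proof (cases "eventually_periodic (\<lambda>k. x (int k))")
    case False
    then show ?thesis using avoiding_sequence_if_not_right_periodic[OF False w slow p av] by blast
  next
    case True
    let ?x = "reversed x" and ?p = "reversed p"
    have np': "\<not> eventually_periodic (\<lambda>k. ?x (int k))"
      using np True by (simp add: eventually_periodic_both_def reversed_def)
    have w': "rev w \<in> factors ?x (length (rev w))" using w by (simp add: factors_reversed)
    have slow': "\<exists>n\<ge>n0. card (factors ?x n) + B < 2 * n" for B n0
      unfolding card_factors_reversed by (rule slow)
    have p': "factors ?p n \<subseteq> factors ?x n" for n
      using p by (auto simp: factors_reversed)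
    have av': "rev w \<notin> factors ?p (length (rev w))"
      using av by (simp add: factors_reversed inj_image_mem_iff)
    note * = avoiding_sequence_if_not_right_periodic[OF np' w' slow' p' av']
    obtain d where d: "d > 0" "\<And>k. ?p (k + int d) = ?p k" using *(1) by blast
    have "p (k + int d) = p k" for k
      using d(2)[of "- 1 - k - int d"] by (simp add: reversed_def)
    moreover obtain n where n: "n \<ge> n0" "\<And>i. \<exists>k\<le>2*n. window ?x (i + int k) n \<in> factors ?p n"
      using *(2) by blast
    have "\<exists>k\<le>2*n. window x (i + int k) n \<in> factors p n" for i
    proof -
      \<comment> \<open>The window of \<open>x\<close> of length \<open>3 * n\<close> at \<open>i\<close> is reflected to the one of \<open>reversed x\<close> at \<open>- i - 3 * n\<close>.\<close>
      obtain k where k: "k \<le> 2 * n" "window ?x (- i - int (3 * n) + int k) n \<in> factors ?p n"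
        using n(2) by blast
      have "- (- i - int (3 * n) + int k) - int n = i + int (2 * n - k)" using k by simp
      then have "rev (window x (i + int (2 * n - k)) n) \<in> rev ` factors p n"
        using k(2) by (simp only: window_reversed factors_reversed)
      then have "window x (i + int (2 * n - k)) n \<in> factors p n"
        by (simp add: inj_image_mem_iff)
      then show ?thesis by (intro exI[of _ "2 * n - k"]) simp
    qed
    ultimately show ?thesis using d n(1) by blast
  qed
  then show "\<exists>d>0. \<forall>k. p (k + int d) = p k"
    and "\<exists>n\<ge>n0. \<forall>i. \<exists>k\<le>2*n. window x (i + int k) n \<in> factors p n" by blast+
qed

section \<open>Subshifts and words\<close>

text \<open>
  Properties that depend on finitely many coordinates define clopen sets: applied to a predicate
  and to its negation, this gives closedness as well.
\<close>

lemma open_window_pred: "open {y :: int \<Rightarrow> 'a::discrete_topology. P (window y i n)}"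
proof -
  have "{y :: int \<Rightarrow> 'a. P (window y i n)} =
    (\<Union>u\<in>{u. length u = n \<and> P u}. {y. \<forall>j\<in>{..<n}. y (i + int j) \<in> {u ! j}})"
  proof (intro set_eqI iffI)
    fix y assume "y \<in> (\<Union>u\<in>{u. length u = n \<and> P u}. {y. \<forall>j\<in>{..<n}. y (i + int j) \<in> {u ! j}})"
    then obtain u where u: "length u = n" "P u" "\<forall>j<n. y (i + int j) = u ! j" by auto
    then have "window y i n = u" by (auto simp: window_def list_eq_iff_nth_eq)
    with u show "y \<in> {y. P (window y i n)}" by simp
  next
    fix y :: "int \<Rightarrow> 'a" assume "y \<in> {y. P (window y i n)}"
    then show "y \<in> (\<Union>u\<in>{u. length u = n \<and> P u}. {y. \<forall>j\<in>{..<n}. y (i + int j) \<in> {u ! j}})"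
      by (auto intro!: exI[of _ "window y i n"] simp: window_def)
  qed
  moreover have "open {y :: int \<Rightarrow> 'a. \<forall>j\<in>{..<n}. y (i + int j) \<in> {u ! j}}" for u
    by (rule product_topology_basis'[OF _ Topological_Spaces.open_discrete]) simp
  ultimately show ?thesis by auto
qed

lemma closed_window_pred: "closed {y :: int \<Rightarrow> 'a::discrete_topology. P (window y i n)}"
  using open_window_pred[of "\<lambda>u. \<not> P u" i n] by (simp add: closed_def Collect_neg_eq)

lemma compact_full_shift: "compact (UNIV :: (int \<Rightarrow> 'a::{finite, topological_space}) set)"
proof -
  have "compact_space (euclidean :: 'a topology)"
    by (simp add: compact_space_def finite_imp_compact)
  then have "compact_space (product_topology (\<lambda>_::int. euclidean :: 'a topology) UNIV)"
    by (simp add: compact_space_product_topology)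
  then show ?thesis
    by (simp add: euclidean_product_topology compact_space_def)
qed

lemma window_shift_pow: "window (shift_pow k x) i n = window x (i + k) n"
  by (simp add: window_def shift_pow_def algebra_simps)

lemma factors_shift_pow: "factors (shift_pow k x) n = factors x n"
proof -
  have "range (\<lambda>i. i + k) = UNIV" by (rule surjI[of _ "\<lambda>i. i - k"]) simp
  have "factors (shift_pow k x) n = (\<lambda>i. window x i n) ` range (\<lambda>i. i + k)"
    by (simp only: factors_def window_shift_pow image_image)
  then show ?thesis by (simp only: \<open>range _ = UNIV\<close> factors_def)
qed

lemma window_in_factors_subwindow:
  assumes "window y i n \<in> factors x n" "s + m \<le> n"
  shows "window y (i + int s) m \<in> factors x m"
proof -
  obtain k where "window y i n = window x k n" using assms(1) unfolding factors_def by blast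
  from window_subwindow[OF this assms(2)] show ?thesis by simp
qed

text \<open>
  This reduces all membership questions for the subshift to statements about words: neighbourhoods
  of \<open>y\<close> constrain finitely many coordinates, and these fit into one window around the origin.
\<close>

lemma orbit_closure_iff_factors:
  fixes x :: "int \<Rightarrow> 'a::discrete_topology"
  shows "y \<in> orbit_closure x \<longleftrightarrow> (\<forall>n. factors y n \<subseteq> factors x n)"
proof
  assume y: "y \<in> orbit_closure x"
  have "window y i n \<in> factors x n" for i n
  proof -
    have "open {z. window z i n = window y i n}" by (rule open_window_pred)
    with y obtain z where "z \<in> orbit x" "window z i n = window y i n"
      unfolding orbit_closure_def closure_iff_nhds_not_empty by blast
    then show ?thesis by (auto simp: orbit_def window_shift_pow) (metis window_in_factors)
  qed
  then show "\<forall>n. factors y n \<subseteq> factors x n" by (auto simp: factors_def)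
next
  assume y: "\<forall>n. factors y n \<subseteq> factors x n"
  have "\<exists>z\<in>orbit x. z \<in> U" if U: "open U" "y \<in> U" for U
  proof -
    from U(1) have "openin (product_topology (\<lambda>_. euclidean) UNIV) U" by (simp add: open_fun_def)
    from product_topology_open_contains_basis[OF this U(2)]
    obtain V where V: "y \<in> (\<Pi>\<^sub>E i\<in>UNIV. V i)" "finite {i. V i \<noteq> UNIV}" "(\<Pi>\<^sub>E i\<in>UNIV. V i) \<subseteq> U"
      by auto
    from V(2) have "finite ((\<lambda>i. nat \<bar>i\<bar>) ` {i. V i \<noteq> UNIV})" by simp
    then obtain N where N: "\<And>i. V i \<noteq> UNIV \<Longrightarrow> nat \<bar>i\<bar> \<le> N"
      unfolding finite_nat_set_iff_bounded_le by blast
    obtain k where k: "window y (- int N) (2 * N + 1) = window x k (2 * N + 1)"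
      using y window_in_factors unfolding factors_def by blast
    let ?z = "shift_pow (k + int N) x"
    have "?z i = y i" if "V i \<noteq> UNIV" for i
    proof -
      define j where "j = nat (i + int N)"
      have j: "int j = i + int N" "j < 2 * N + 1" using N[OF that] by (auto simp: j_def)
      have "y (- int N + int j) = x (k + int j)"
        using k j(2) unfolding window_eq_iff by blast
      then show ?thesis by (simp add: j(1) shift_pow_def algebra_simps)
    qed
    then have "?z i \<in> V i" for i using V(1) by (cases "V i = UNIV") (auto simp: PiE_iff)
    then have "?z \<in> U" using V(3) by (auto simp: PiE_iff)
    then show ?thesis by (auto simp: orbit_def)
  qed
  then show "y \<in> orbit_closure x"
    unfolding orbit_closure_def closure_iff_nhds_not_empty by blast
qed

lemma subword_iff_factors: "subword w x \<longleftrightarrow> w \<in> factors x (length w)"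
proof -
  have "w = window x i (length w) \<longleftrightarrow> (\<forall>j<length w. w ! j = x (i + int j))" for i
    unfolding window_def by (subst list_eq_iff_nth_eq) auto
  then have "w \<in> factors x (length w) \<longleftrightarrow> (\<exists>i. \<forall>j<length w. w ! j = x (i + int j))"
    by (simp only: factors_def image_iff bex_UNIV)
  then show ?thesis unfolding subword_def by (simp add: eq_commute[of "w ! _"])
qed

lemma word_complexity_orbit_closure:
  fixes x :: "int \<Rightarrow> 'a::discrete_topology"
  shows "word_complexity (orbit_closure x) n = card (factors x n)"
proof -
  have "{w. length w = n \<and> (\<exists>y\<in>orbit_closure x. subword w y)} = factors x n"
  proof (intro set_eqI iffI)
    fix w assume "w \<in> factors x n"
    moreover have "length w = n" using \<open>w \<in> factors x n\<close> by (auto simp: factors_def)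
    moreover have "x \<in> orbit_closure x" by (simp add: orbit_closure_iff_factors)
    ultimately show "w \<in> {w. length w = n \<and> (\<exists>y\<in>orbit_closure x. subword w y)}"
      by (auto simp: subword_iff_factors)
  qed (auto simp: subword_iff_factors orbit_closure_iff_factors subset_iff)
  then show ?thesis by (simp add: word_complexity_def)
qed

lemma sublist_window:
  assumes "s + m \<le> n"
  shows "sublist (window y (i + int s) m) (window y i n)"
proof -
  have "window y (i + int s) m = take m (drop s (window y i n))"
    by (rule nth_equalityI) (use assms in \<open>auto simp: window_def add.assoc\<close>)
  then show ?thesis by (simp add: sublist_order.order_trans[OF sublist_take sublist_drop])
qed

text \<open>
  Failure of uniform recurrence gives arbitrarily long words of \<open>x\<close> that omit \<open>w\<close>. Centring them at
  the origin and passing to a limit by compactness gives a bi-infinite sequence that omits \<open>w\<close>.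
\<close>

lemma not_uniformly_recurrent_imp_avoiding:
  fixes x :: "int \<Rightarrow> 'a::{finite, discrete_topology}"
  assumes "\<not> uniformly_recurrent x"
  obtains w p where "w \<in> factors x (length w)" "\<And>n. factors p n \<subseteq> factors x n"
    "w \<notin> factors p (length w)"
proof -
  obtain w where w: "subword w x"
    and gaps: "\<And>N. N > 0 \<Longrightarrow> \<exists>v. length v = N \<and> subword v x \<and> \<not> sublist w v"
    using assms unfolding uniformly_recurrent_def by blast
  define F where "F N = {y. window y (- int N) (2 * N + 1) \<in> factors x (2 * N + 1) \<and>
    \<not> sublist w (window y (- int N) (2 * N + 1))}" for N
  have anti: "F N \<subseteq> F K" if "K \<le> N" for K N
  proof
    fix y assume y: "y \<in> F N"
    have s: "- int N + int (N - K) = - int K" "N - K + (2 * K + 1) \<le> 2 * N + 1" using that by auto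
    show "y \<in> F K"
      using y window_in_factors_subwindow[of y "- int N" "2 * N + 1" x, OF _ s(2)]
        sublist_window[OF s(2), of y "- int N"]
      unfolding s(1) F_def by (auto dest: sublist_order.order_trans)
  qed
  have nonempty: "F N \<noteq> {}" for N
  proof -
    obtain v where v: "length v = 2 * N + 1" "subword v x" "\<not> sublist w v"
      using gaps[of "2 * N + 1"] by auto
    then obtain i where i: "v = window x i (2 * N + 1)"
      by (auto simp: subword_iff_factors factors_def)
    have "shift_pow (i + int N) x \<in> F N"
      using v i by (simp add: F_def window_shift_pow)
    then show ?thesis by blast
  qed
  have "UNIV \<inter> (\<Inter>N\<in>UNIV. F N) \<noteq> {}"
  proof (rule compact_imp_fip_image[OF compact_full_shift])
    show "closed (F N)" for N
      unfolding F_def by (rule closed_window_pred)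
    fix I :: "nat set" assume "finite I"
    then obtain N where "\<And>K. K \<in> I \<Longrightarrow> K \<le> N" unfolding finite_nat_set_iff_bounded_le by blast
    then have "F N \<subseteq> (\<Inter>K\<in>I. F K)" using anti by blast
    then show "UNIV \<inter> (\<Inter>K\<in>I. F K) \<noteq> {}" using nonempty[of N] by blast
  qed
  then obtain p where p: "\<And>N. p \<in> F N" by blast
  have big: "window p i n \<in> factors x n \<and> (n = length w \<longrightarrow> window p i n \<noteq> w)" for i n
  proof -
    define N where "N = nat \<bar>i\<bar> + n"
    define s where "s = nat (i + int N)"
    have s: "- int N + int s = i" "s + n \<le> 2 * N + 1" by (auto simp: s_def N_def)
    show ?thesis
      using p[of N] window_in_factors_subwindow[of p "- int N" "2 * N + 1" x, OF _ s(2)]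
        sublist_window[OF s(2), of p "- int N"]
      unfolding s(1) F_def by auto
  qed
  show thesis
  proof (rule that)
    show "w \<in> factors x (length w)" using w by (simp add: subword_iff_factors)
    show "factors p n \<subseteq> factors x n" for n using big by (auto simp: factors_def)
    show "w \<notin> factors p (length w)" using big unfolding factors_def by (metis rangeE)
  qed
qed

lemma liminf_imp_frequently_slow:
  fixes c :: "nat \<Rightarrow> nat"
  assumes "liminf (\<lambda>n. ereal (real (c n) - 2 * real n)) = -\<infinity>"
  shows "\<exists>n\<ge>n0. c n + B < 2 * n"
proof (rule ccontr)
  assume "\<not> ?thesis"
  then have "\<forall>n\<ge>n0. 2 * n \<le> c n + B" by (meson not_le)
  then have "eventually (\<lambda>n. ereal (- real B) \<le> ereal (real (c n) - 2 * real n)) sequentially"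
    unfolding eventually_sequentially by (intro exI[of _ n0]) (fastforce simp flip: of_nat_add)
  then have "ereal (- real B) \<le> liminf (\<lambda>n. ereal (real (c n) - 2 * real n))"
    by (rule Liminf_bounded)
  with assms show False by simp
qed

section \<open>Invariant measures\<close>

context
  fixes X :: "(int \<Rightarrow> 'a::topological_space) set" and M
  assumes M: "M \<in> invariant_measures X"
begin

interpretation prob_space M using M by (simp add: invariant_measures_def)

lemma space_invariant: "space M = X"
proof -
  have "sets M = sets (restrict_space borel X)" using M by (simp add: invariant_measures_def)
  from sets_eq_imp_space_eq[OF this] show ?thesis by (simp add: space_restrict_space)
qed

lemma shift_pow_measurable: "shift_pow (int k) \<in> measurable M M"
proof (induction k)
  case 0
  have "shift_pow 0 = (\<lambda>y :: int \<Rightarrow> 'a. y)" by (auto simp: shift_pow_def)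
  then show ?case by simp
next
  case (Suc k)
  have "shift_pow (int (Suc k)) = (\<lambda>y :: int \<Rightarrow> 'a. left_shift (shift_pow (int k) y))"
    by (auto simp: shift_pow_add[symmetric])
  moreover have "left_shift \<in> measurable M M" using M by (simp add: invariant_measures_def)
  ultimately show ?case using Suc by simp
qed

lemma measure_vimage_left_shift:
  assumes "A \<in> sets M"
  shows "measure M (left_shift -` A \<inter> X) = measure M A"
proof -
  have "left_shift \<in> measurable M M" "distr M M left_shift = M" using M by (simp_all add: invariant_measures_def)
  then show ?thesis using measure_distr[of left_shift M M A] assms by (simp add: space_invariant)
qed

lemma measure_vimage_shift_pow:
  assumes "A \<in> sets M"
  shows "measure M (shift_pow (int k) -` A \<inter> X) = measure M A"
proof (induction k)
  case 0
  have "shift_pow 0 -` A \<inter> X = A"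
    using sets.sets_into_space[OF assms] by (auto simp: shift_pow_0 space_invariant)
  then show ?case by simp
next
  case (Suc k)
  have "shift_pow (int (Suc k)) -` A \<inter> X = left_shift -` (shift_pow (int k) -` A \<inter> X) \<inter> X"
  proof -
    have "left_shift y \<in> X" if "y \<in> X" for y
      using measurable_space[OF shift_pow_measurable[of 1]] that by (simp add: space_invariant)
    moreover have "shift_pow (int (Suc k)) y = shift_pow (int k) (left_shift y)" for y :: "int \<Rightarrow> 'a"
      by (simp add: shift_pow_add[symmetric] add.commute)
    ultimately show ?thesis by auto
  qed
  moreover have "shift_pow (int k) -` A \<inter> X \<in> sets M"
    using measurable_sets[OF shift_pow_measurable assms] by (simp add: space_invariant)
  ultimately show ?case using Suc measure_vimage_left_shift by metis
qed

end

text \<open>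
  Double counting: integrate the number of sets \<open>B s\<close> that contain a point.
\<close>

lemma (in finite_measure) measure_le_sum_of_multicover:
  assumes fin: "finite S" and B: "\<And>s. s \<in> S \<Longrightarrow> B s \<in> sets M" and Z: "Z \<in> sets M"
    and cover: "\<And>y. y \<in> Z \<Longrightarrow> k \<le> card {s \<in> S. y \<in> B s}"
  shows "real k * measure M Z \<le> (\<Sum>s\<in>S. measure M (B s))"
proof -
  have "real k * measure M Z = (\<integral>y. real k * indicator Z y \<partial>M)"
    using Z by simp
  also have "\<dots> \<le> (\<integral>y. (\<Sum>s\<in>S. indicator (B s) y) \<partial>M)"
  proof (rule integral_mono)
    show "integrable M (\<lambda>y. real k * indicator Z y)"
      using Z by (intro integrable_mult_right integrable_real_indicator) (auto simp: less_top[symmetric])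
    show "integrable M (\<lambda>y. \<Sum>s\<in>S. indicator (B s) y :: real)"
      using B by (intro Bochner_Integration.integrable_sum integrable_real_indicator) (auto simp: less_top[symmetric])
    fix y
    have "(\<Sum>s\<in>S. indicator (B s) y :: real) = real (card {s \<in> S. y \<in> B s})"
      using fin by (simp add: indicator_def sum.If_cases Int_def)
    then show "real k * indicator Z y \<le> (\<Sum>s\<in>S. indicator (B s) y)"
      using cover[of y] by (cases "y \<in> Z") auto
  qed
  also have "\<dots> = (\<Sum>s\<in>S. measure M (B s))"
    using B by (subst Bochner_Integration.integral_sum) (auto simp: less_top[symmetric] intro!: integrable_real_indicator)
  finally show ?thesis .
qed

lemma periodic_multiple:
  assumes d: "\<forall>k. p (k + int d) = p k"
  shows "p (k + int d * l) = p k"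
proof (induction l rule: int_induct[where k = 0])
  case (step1 i)
  then show ?case using d[rule_format, of "k + int d * i"] by (simp add: algebra_simps)
next
  case (step2 i)
  then show ?case using d[rule_format, of "k + int d * (i - 1)"] by (simp add: algebra_simps)
qed simp

text \<open>
  A periodic sequence has only finitely many shifts. If each of them disagreed with \<open>y\<close> somewhere,
  one central window of \<open>y\<close> would contain all these disagreements and could not be a word of \<open>p\<close>.
\<close>

lemma mem_orbit_iff_windows:
  assumes d: "d > 0" "\<forall>k. p (k + int d) = p k"
  shows "y \<in> orbit p \<longleftrightarrow> (\<forall>m. window y (- int m) (2 * m + 1) \<in> factors p (2 * m + 1))"
proof
  assume "y \<in> orbit p"
  then show "\<forall>m. window y (- int m) (2 * m + 1) \<in> factors p (2 * m + 1)"
    by (auto simp: orbit_def window_shift_pow)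
next
  assume y: "\<forall>m. window y (- int m) (2 * m + 1) \<in> factors p (2 * m + 1)"
  note per = periodic_multiple[OF d(2)]
  show "y \<in> orbit p"
  proof (rule ccontr)
    assume "y \<notin> orbit p"
    then have "\<exists>j. y j \<noteq> p (j + e)" for e by (auto simp: orbit_def shift_pow_def)
    then obtain J where J: "\<And>e. y (J e) \<noteq> p (J e + e)" by metis
    define m where "m = Max ((\<lambda>e. nat \<bar>J e\<bar>) ` {0..<int d})"
    have m: "nat \<bar>J e\<bar> \<le> m" if "e \<in> {0..<int d}" for e
      unfolding m_def using that by (intro Max_ge) auto
    obtain i where i: "window y (- int m) (2 * m + 1) = window p i (2 * m + 1)"
      using y by (auto simp: factors_def)
    define e where "e = (i + int m) mod int d"
    have e: "e \<in> {0..<int d}" using d(1) by (simp add: e_def)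
    define j where "j = nat (J e + int m)"
    have j: "int j = J e + int m" "j < 2 * m + 1" using m[OF e] by (auto simp: j_def)
    have "y (- int m + int j) = p (i + int j)" using i j(2) unfolding window_eq_iff by blast
    also have "\<dots> = p (J e + e + int d * ((i + int m) div int d))"
      unfolding e_def j(1) by (simp add: algebra_simps)
    finally show False using J[of e] per j(1) by simp
  qed
qed

text \<open>
  Let \<open>W m\<close> be the set of points whose window of radius \<open>m\<close> around the origin is a word of \<open>p\<close>; these
  sets decrease to the orbit of \<open>p\<close>. A word of \<open>p\<close> of length \<open>n\<close> contributes \<open>n - 2 * m\<close> shifts that
  lie in \<open>W m\<close>, and it is found within the first \<open>3 * n\<close> coordinates of each point. So at least a
  sixth of the first \<open>3 * n\<close> shifts of the point lie in \<open>W m\<close>. The complement \<open>Z\<close> of the orbit is invariant, hence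
  averaging over it gives \<open>measure M Z \<le> 6 * measure M (W m \<inter> Z)\<close>, whose right-hand side tends to 0.
\<close>

lemma invariant_measure_null_off_syndetic_orbit:
  fixes X :: "(int \<Rightarrow> 'a::discrete_topology) set"
  assumes M: "M \<in> invariant_measures X"
    and d: "d > 0" "\<forall>k. p (k + int d) = p k"
    and dense: "\<And>n0. \<exists>n\<ge>n0. \<forall>y\<in>X. \<exists>k\<le>2*n. window y (int k) n \<in> factors p n"
  shows "orbit p \<inter> X \<in> sets M" "measure M (X - orbit p) = 0"
proof -
  interpret prob_space M using M by (simp add: invariant_measures_def)
  note space = space_invariant[OF M]
  define W where "W m = {y. window y (- int m) (2 * m + 1) \<in> factors p (2 * m + 1)} \<inter> X" for m
  have sets_M: "A \<inter> X \<in> sets M" if "A \<in> sets borel" for A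
    using M that by (auto simp: invariant_measures_def sets_restrict_space)
  have W: "W m \<in> sets M" for m
    unfolding W_def by (intro sets_M borel_open open_window_pred)
  have orbit_W: "orbit p \<inter> X = (\<Inter>m. W m)"
    by (auto simp: W_def mem_orbit_iff_windows[OF d])
  show orbit_M: "orbit p \<inter> X \<in> sets M"
    unfolding orbit_W using W by (intro sets.countable_INT) auto
  let ?Z = "X - orbit p"
  have Z: "?Z \<in> sets M"
    using sets.compl_sets[OF orbit_M] by (simp add: space Diff_Int_distrib2 Diff_Int)
  have shift_X: "shift_pow (int s) y \<in> X" if "y \<in> X" for s y
    using measurable_space[OF shift_pow_measurable[OF M]] that by (simp add: space)
  have shift_Z: "shift_pow (int s) y \<in> ?Z" if "y \<in> ?Z" for s y
  proof -
    have "y \<in> orbit p" if "shift_pow (int s) y = shift_pow l p" for l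
    proof -
      have "y = shift_pow (- int s) (shift_pow (int s) y)" by (simp add: shift_pow_def)
      also have "\<dots> = shift_pow (- int s + l) p" unfolding that by (simp only: shift_pow_add)
      finally show ?thesis by (simp add: orbit_def)
    qed
    with that shift_X show ?thesis by (auto simp: orbit_def)
  qed
  have decseq: "decseq (\<lambda>m. W m \<inter> ?Z)"
  proof (rule decseq_SucI)
    fix m
    have "W (Suc m) \<subseteq> W m"
    proof
      fix y assume y: "y \<in> W (Suc m)"
      then have "window y (- int (Suc m)) (2 * Suc m + 1) \<in> factors p (2 * Suc m + 1)" by (simp add: W_def)
      from window_in_factors_subwindow[OF this, of 1 "2 * m + 1"] y
      show "y \<in> W m" by (simp add: W_def)
    qed
    then show "W (Suc m) \<inter> ?Z \<subseteq> W m \<inter> ?Z" by blast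
  qed
  have bound: "measure M ?Z \<le> 6 * measure M (W m \<inter> ?Z)" for m
  proof -
    \<comment> \<open>With \<open>n \<ge> 4 * m\<close> at least half of the positions in a word of length \<open>n\<close> are centres of windows of radius \<open>m\<close>.\<close>
    obtain n where n: "n \<ge> 4 * m + 1" and hit: "\<forall>y\<in>X. \<exists>k\<le>2*n. window y (int k) n \<in> factors p n"
      using dense by blast
    let ?B = "\<lambda>s. shift_pow (int s) -` (W m \<inter> ?Z) \<inter> X"
    have "real (n - 2 * m) * measure M ?Z \<le> (\<Sum>s\<in>{..<3*n}. measure M (?B s))"
    proof (rule measure_le_sum_of_multicover)
      show "?B s \<in> sets M" for s
        using measurable_sets[OF shift_pow_measurable[OF M], of "W m \<inter> ?Z" s] W Z by (simp add: space)
      fix y assume y: "y \<in> ?Z"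
      then obtain k where k: "k \<le> 2 * n" "window y (int k) n \<in> factors p n" using hit by blast
      have "{k + m..<k + n - m} \<subseteq> {s \<in> {..<3*n}. y \<in> ?B s}"
      proof
        fix s assume s: "s \<in> {k + m..<k + n - m}"
        have "int k + int (s - k - m) = int s - int m" using s by auto
        moreover have "s - k - m + (2 * m + 1) \<le> n" using s by auto
        ultimately have "window y (int s - int m) (2 * m + 1) \<in> factors p (2 * m + 1)"
          using window_in_factors_subwindow[OF k(2)] by metis
        then have "shift_pow (int s) y \<in> W m"
          using shift_X y by (simp add: W_def window_shift_pow)
        then show "s \<in> {s \<in> {..<3*n}. y \<in> ?B s}" using shift_Z[OF y] y s k(1) by auto
      qed
      from card_mono[OF _ this] show "n - 2 * m \<le> card {s \<in> {..<3*n}. y \<in> ?B s}" by simp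
    qed (use Z in auto)
    also have "\<dots> = real (3 * n) * measure M (W m \<inter> ?Z)"
      by (subst sum.cong[OF refl measure_vimage_shift_pow[OF M sets.Int[OF W Z]]]) simp_all
    finally have le: "real (n - 2 * m) * measure M ?Z \<le> real (3 * n) * measure M (W m \<inter> ?Z)" .
    have "real n * measure M ?Z \<le> (2 * real (n - 2 * m)) * measure M ?Z"
      using n by (intro mult_right_mono) auto
    also have "\<dots> \<le> real n * (6 * measure M (W m \<inter> ?Z))" using le by (simp add: mult_ac)
    finally show ?thesis using n by (simp add: mult_le_cancel_left)
  qed
  have "(\<lambda>m. measure M (W m \<inter> ?Z)) \<longlonglongrightarrow> measure M (\<Inter>m. W m \<inter> ?Z)"
    using W Z decseq by (intro finite_Lim_measure_decseq) auto
  moreover have "(\<Inter>m. W m \<inter> ?Z) = {}" using orbit_W by blast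
  ultimately have "(\<lambda>m. 6 * measure M (W m \<inter> ?Z)) \<longlonglongrightarrow> 6 * 0"
    by (intro tendsto_mult) simp_all
  then have "measure M ?Z \<le> 6 * 0" by (rule LIMSEQ_le_const) (use bound in blast)
  then show "measure M ?Z = 0" by (simp add: antisym)
qed

lemma periodic_orbit_eq:
  assumes d: "d > 0" "\<forall>k. p (k + int d) = p k"
  shows "orbit p = (\<lambda>k. shift_pow (int k) p) ` {..<d}"
proof
  note per = periodic_multiple[OF d(2)]
  show "orbit p \<subseteq> (\<lambda>k. shift_pow (int k) p) ` {..<d}"
  proof
    fix y assume "y \<in> orbit p"
    then obtain l where l: "y = shift_pow l p" by (auto simp: orbit_def)
    have "y k = p (k + int (nat (l mod int d)))" for k
      using per[of "k + l mod int d" "l div int d"] d(1)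
      by (simp add: l shift_pow_def add.assoc)
    then have "y = shift_pow (int (nat (l mod int d))) p" by (simp add: shift_pow_def fun_eq_iff)
    moreover have "nat (l mod int d) < d" using d(1) by (simp add: nat_less_iff)
    ultimately show "y \<in> (\<lambda>k. shift_pow (int k) p) ` {..<d}" by blast
  qed
qed (auto simp: orbit_def)

text \<open>
  Invariance moves the mass of one point of the orbit to the next, so all points of the finite orbit
  have the same mass. This formula determines the measure.
\<close>

lemma measure_on_periodic_orbit:
  fixes X :: "(int \<Rightarrow> 'a::discrete_topology) set"
  assumes M: "M \<in> invariant_measures X"
    and d: "d > 0" "\<forall>k. p (k + int d) = p k" and sub: "orbit p \<subseteq> X"
    and null: "measure M (X - orbit p) = 0" and A: "A \<in> sets M"
  shows "measure M A = real (card (A \<inter> orbit p)) / real (card (orbit p))"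
proof -
  interpret prob_space M using M by (simp add: invariant_measures_def)
  note space = space_invariant[OF M]
  have singleton: "{y} \<in> sets M" if "y \<in> X" for y
  proof -
    have "{y} = (\<Inter>m. {z. window z (- int m) (2 * m + 1) = window y (- int m) (2 * m + 1)})"
    proof (intro set_eqI iffI)
      fix z assume z: "z \<in> (\<Inter>m. {z. window z (- int m) (2 * m + 1) = window y (- int m) (2 * m + 1)})"
      have "z i = y i" for i
      proof -
        define m where "m = nat \<bar>i\<bar>"
        have "window z (- int m) (2 * m + 1) = window y (- int m) (2 * m + 1)" using z by blast
        moreover have "nat (i + int m) < 2 * m + 1" by (auto simp: m_def)
        ultimately have "z (- int m + int (nat (i + int m))) = y (- int m + int (nat (i + int m)))"
          unfolding window_eq_iff by blast
        moreover have "- int m + int (nat (i + int m)) = i" by (auto simp: m_def)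
        ultimately show ?thesis by simp
      qed
      then show "z \<in> {y}" by auto
    qed simp
    moreover have "closed (\<Inter>m. {z. window z (- int m) (2 * m + 1) = window y (- int m) (2 * m + 1)})"
      by (intro closed_INT ballI closed_window_pred)
    ultimately have "{y} \<inter> X \<in> sets M"
      using M by (auto simp: invariant_measures_def sets_restrict_space)
    then show ?thesis using that by simp
  qed
  have orbitX: "shift_pow l p \<in> X" for l using sub by (auto simp: orbit_def)
  have mass: "measure M {shift_pow (int k) p} = measure M {p}" for k
  proof (induction k)
    case (Suc k)
    have "left_shift -` {shift_pow (int (Suc k)) p} \<inter> X = {shift_pow (int k) p}"
    proof -
      have "y = shift_pow (int k) p" if "left_shift y = shift_pow (int (Suc k)) p" for y
      proof -
        have "y = shift_pow (- 1) (left_shift y)" by (simp add: shift_pow_def)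
        then show ?thesis unfolding that by (simp add: shift_pow_def)
      qed
      then show ?thesis using orbitX by (auto simp: shift_pow_add[symmetric])
    qed
    with Suc measure_vimage_left_shift[OF M singleton[OF orbitX], of "int (Suc k)"] show ?case by simp
  qed (simp add: shift_pow_0)
  have fin: "finite (orbit p)" by (simp add: periodic_orbit_eq[OF d])
  have conc: "measure M B = real (card (B \<inter> orbit p)) * measure M {p}" if B: "B \<in> sets M" for B
  proof -
    have "B \<inter> orbit p \<in> sets M"
    proof -
      have "finite (B \<inter> orbit p)" using fin by simp
      moreover have "(\<Union>y\<in>B \<inter> orbit p. {y}) \<in> sets M"
        using calculation singleton sub by (intro sets.finite_UN) auto
      ultimately show ?thesis by simp
    qed
    moreover have "orbit p \<in> sets M"
    proof -
      have "(\<Union>y\<in>orbit p. {y}) \<in> sets M"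
        using fin singleton sub by (intro sets.finite_UN) auto
      then show ?thesis by simp
    qed
    moreover have "measure M (B - orbit p) \<le> measure M (X - orbit p)"
      using sets.sets_into_space[OF B] sets.compl_sets[OF \<open>orbit p \<in> sets M\<close>] unfolding space
      by (intro finite_measure_mono) auto
    ultimately have "measure M B = measure M (B \<inter> orbit p)"
      using finite_measure_Diff'[of B "orbit p"] B null measure_nonneg[of M "B - orbit p"] by linarith
    also have "\<dots> = (\<Sum>y\<in>B \<inter> orbit p. measure M {y})"
      using fin singleton sub by (intro finite_measure_eq_sum_singleton) auto
    also have "\<dots> = (\<Sum>y\<in>B \<inter> orbit p. measure M {p})"
      using mass by (intro sum.cong) (auto simp: periodic_orbit_eq[OF d])
    finally show ?thesis by simp
  qed
  have "1 = real (card (orbit p)) * measure M {p}"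
    using conc[OF sets.top] prob_space sub by (simp add: space Int_absorb1)
  then have "measure M {p} = 1 / real (card (orbit p))"
    by (metis nonzero_mult_div_cancel_left mult_zero_left zero_neq_one)
  with conc[OF A] show ?thesis by simp
qed

text \<open>
  The measure is the image of the uniform distribution on \<open>{..<d}\<close>. The shift acts on indices as
  \<open>k \<mapsto> Suc k mod d\<close>, a permutation that preserves the uniform distribution. Indexing by
  \<open>{..<d}\<close> instead of the orbit itself allows \<open>d\<close> to be any multiple of the least period.
\<close>

lemma ex_invariant_measure_on_periodic_orbit:
  fixes X :: "(int \<Rightarrow> 'a::topological_space) set"
  assumes d: "d > 0" "\<forall>k. p (k + int d) = p k" and sub: "orbit p \<subseteq> X"
    and inv: "\<And>y. y \<in> X \<Longrightarrow> left_shift y \<in> X"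
  shows "\<exists>M. M \<in> invariant_measures X"
proof -
  let ?P = "measure_pmf (pmf_of_set {..<d})" and ?R = "restrict_space borel X"
  let ?f = "\<lambda>k. shift_pow (int k) p"
  define M where "M = distr ?P ?R ?f"
  have f: "?f \<in> measurable ?P ?R"
    using sub by (auto simp: orbit_def space_restrict_space)
  have sets_M: "sets M = sets ?R" by (simp add: M_def)
  have "continuous_on UNIV (left_shift :: (int \<Rightarrow> 'a) \<Rightarrow> _)"
    unfolding shift_pow_def by (intro continuous_on_coordinatewise_then_product continuous_on_product_coordinates)
  then have "left_shift \<in> measurable (borel :: (int \<Rightarrow> 'a) measure) borel"
    by (rule borel_measurable_continuous_onI)
  then have shift_R: "left_shift \<in> measurable ?R ?R"
    using inv by (intro measurable_restrict_space3) auto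
  have set_P: "set_pmf (pmf_of_set {..<d}) = {..<d}"
    using d(1) by (intro set_pmf_of_set) auto
  define h where "h k = Suc k mod d" for k
  have h_surj: "h ` {..<d} = {..<d}"
  proof
    show "{..<d} \<subseteq> h ` {..<d}"
    proof
      fix j assume "j \<in> {..<d}"
      then have "j = h (if j = 0 then d - 1 else j - 1)" "(if j = 0 then d - 1 else j - 1) < d"
        using d(1) by (auto simp: h_def)
      then show "j \<in> h ` {..<d}" by blast
    qed
  qed (use d in \<open>auto simp: h_def\<close>)
  then have "inj_on h {..<d}" by (intro eq_card_imp_inj_on) auto
  then have "map_pmf h (pmf_of_set {..<d}) = pmf_of_set {..<d}"
    using d(1) h_surj by (subst map_pmf_of_set_inj) auto
  then have h_P: "distr ?P (count_space UNIV) h = ?P" by (metis map_pmf_rep_eq)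
  have shift_f: "left_shift (?f k) = ?f (h k)" if "k < d" for k
  proof (cases "Suc k = d")
    case True
    have "shift_pow (int d) p = shift_pow 0 p" using d(2) by (simp add: shift_pow_def)
    moreover have "left_shift (?f k) = shift_pow (int (Suc k)) p" by (simp add: shift_pow_add[symmetric])
    ultimately show ?thesis using True by (simp add: h_def)
  next
    case False
    with that show ?thesis by (simp add: h_def shift_pow_add[symmetric])
  qed
  have "distr M M left_shift = distr M ?R left_shift" by (rule distr_cong) (simp_all add: sets_M)
  also have "\<dots> = distr ?P ?R (left_shift \<circ> ?f)" unfolding M_def by (rule distr_distr[OF shift_R f])
  also have "\<dots> = distr ?P ?R (?f \<circ> h)"
  proof (rule distr_cong_AE)
    show "AE k in ?P. (left_shift \<circ> ?f) k = (?f \<circ> h) k"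
      using shift_f by (simp add: AE_measure_pmf_iff set_P)
      show "left_shift \<circ> ?f \<in> measurable ?P ?R" by (rule measurable_comp[OF f shift_R])
    show "?f \<circ> h \<in> measurable ?P ?R"
      using sub by (auto simp: orbit_def space_restrict_space)
  qed (rule refl)+
  also have "\<dots> = distr (distr ?P (count_space UNIV) h) ?R ?f"
    by (rule distr_distr[symmetric]) (use f in auto)
  also have "\<dots> = M" by (simp add: h_P M_def)
  finally have "distr M M left_shift = M" .
  moreover have "prob_space M" unfolding M_def by (rule prob_space.prob_space_distr[OF prob_space_measure_pmf f])
  moreover have "left_shift \<in> measurable M M" using shift_R by (simp add: measurable_cong_sets[OF sets_M sets_M])
  ultimately show ?thesis using sets_M unfolding invariant_measures_def by blast
qed

section \<open>Unique ergodicity\<close>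

theorem theorem1p5:
  fixes x :: "int \<Rightarrow> 'a::{finite, discrete_topology}"
    and X :: "(int \<Rightarrow> 'a) set"
  assumes "X = orbit_closure x"
    and "\<not> uniformly_recurrent x"
    and "\<not> eventually_periodic_both x"
    and "liminf (\<lambda>n. ereal (real (word_complexity X n) - 2 * real n)) = -\<infinity>"
  shows "uniquely_ergodic X \<and>
    (\<forall>M \<in> invariant_measures X. supported_on_periodic_orbit X M)"
proof -
  have X_iff: "y \<in> X \<longleftrightarrow> (\<forall>n. factors y n \<subseteq> factors x n)" for y
    by (simp add: assms(1) orbit_closure_iff_factors)
  have slow: "\<exists>n\<ge>n0. card (factors x n) + B < 2 * n" for B n0
    using assms(4) unfolding assms(1) word_complexity_orbit_closure by (rule liminf_imp_frequently_slow)
  obtain w p where w: "w \<in> factors x (length w)" and p: "\<And>n. factors p n \<subseteq> factors x n"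
    and av: "w \<notin> factors p (length w)"
    using not_uniformly_recurrent_imp_avoiding[OF assms(2)] by metis
  note dense = avoiding_sequence_periodic_and_syndetic[OF assms(3) w slow p av]
  obtain d where d: "d > 0" "\<forall>k. p (k + int d) = p k" using dense(1) by blast
  \<comment> \<open>The property passes from \<open>x\<close> to its orbit closure, because each window of \<open>y\<close> is a window of \<open>x\<close>.\<close>
  have hit: "\<exists>n\<ge>n0. \<forall>y\<in>X. \<exists>k\<le>2*n. window y (int k) n \<in> factors p n" for n0
  proof -
    obtain n where n: "n \<ge> n0" and hit_x: "\<And>i. \<exists>k\<le>2*n. window x (i + int k) n \<in> factors p n"
      using dense(2) by blast
    have "\<exists>k\<le>2*n. window y (int k) n \<in> factors p n" if "y \<in> X" for y
    proof -
      have "window y 0 (3 * n) \<in> factors x (3 * n)" using that X_iff window_in_factors by blast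
      then obtain i where i: "window y 0 (3 * n) = window x i (3 * n)" by (auto simp: factors_def)
      obtain k where k: "k \<le> 2 * n" "window x (i + int k) n \<in> factors p n" using hit_x by blast
      with window_subwindow[OF i, of k n] show ?thesis by auto
    qed
    with n show ?thesis by blast
  qed
  have sub: "orbit p \<subseteq> X" using p by (auto simp: X_iff orbit_def factors_shift_pow)
  have null: "measure M (X - orbit p) = 0" if "M \<in> invariant_measures X" for M
    using invariant_measure_null_off_syndetic_orbit(2)[OF that d hit] .
  note mass = measure_on_periodic_orbit[OF _ d sub null]
  have "\<exists>!M. M \<in> invariant_measures X"
  proof (rule ex_ex1I)
    show "\<exists>M. M \<in> invariant_measures X"
      by (rule ex_invariant_measure_on_periodic_orbit[OF d sub]) (simp add: X_iff factors_shift_pow)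
    fix M N assume MN: "M \<in> invariant_measures X" "N \<in> invariant_measures X"
    interpret M: prob_space M using MN(1) by (simp add: invariant_measures_def)
    interpret N: prob_space N using MN(2) by (simp add: invariant_measures_def)
    have sets_eq: "sets M = sets N" using MN by (simp add: invariant_measures_def)
    then show "M = N"
    proof (rule measure_eqI)
      fix A assume A: "A \<in> sets M"
      then show "emeasure M A = emeasure N A"
        using mass[OF MN(1) MN(1) A] mass[OF MN(2) MN(2), of A] sets_eq
        by (simp add: M.emeasure_eq_measure N.emeasure_eq_measure)
    qed
  qed
  moreover have "supported_on_periodic_orbit X M" if M: "M \<in> invariant_measures X" for M
  proof -
    interpret prob_space M using M by (simp add: invariant_measures_def)
    have "orbit p \<in> sets M"
      using invariant_measure_null_off_syndetic_orbit(1)[OF M d hit] sub by (simp add: Int_absorb2)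
    then have "emeasure M (orbit p) = 1"
      using mass[OF M M, of "orbit p"] d(1) prob_compl[of "orbit p"] null[OF M]
      by (simp add: emeasure_eq_measure space_invariant[OF M])
    moreover have "periodic p" unfolding periodic_def using d by (intro exI[of _ "int d"]) auto
    ultimately show ?thesis unfolding supported_on_periodic_orbit_def using sub by blast
  qed
  ultimately show ?thesis unfolding uniquely_ergodic_def by blast
qed

end
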